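(* Let $A\in\mathbb{R}^{m\times n}$, $\vec b\in\mathbb{R}^n$, and let $k\ge 3$ be such that $k+1$ is less than the invariance index of the Krylov subspaces generated by $A^TA$ and $\vec b$. Let $Q_k=[\vec q_1,\dots,\vec q_k]\in\mathbb{R}^{n\times k}$ be the matrix with orthonormal columns generated by the rational Arnoldi algorithm applied to $A^TA$ with starting vector $\vec b$ and nonzero poles $\xi_1,\dots,\xi_{k-1}\in(\mathbb{R}\cup\{\infty\})\setminus\{0\}$. Let $AQ_k=P_kB_k$ be the QR decomposition, where $P_k=[\vec p_1,\dots,\vec p_k]\in\mathbb{R}^{m\times k}$ has orthonormal columns and $B_k\in\mathbb{R}^{k\times k}$ is upper triangular with positive diagonal. Denote $d_i=(B_k)_{i,i}$, $\beta_i=(B_k)_{i,i+1}$, $\gamma_i=(B_k)_{i,i+2}$, and for $2\le j\le k$ let $\vec x_j=\sum_{i=1}^{j-1}(B_k)_{i,j}\,\vec p_i$. Assume $\beta_{k-2}\ne0$. Then $$\beta_{k-1}=\vec p_{k-1}^TA\vec q_k,\qquad \gamma_{k-2}=\vec p_{k-2}^TA\vec q_k,\qquad \vec x_k=\frac{\gamma_{k-2}}{\beta_{k-2}}\,\vec x_{k-1}+\beta_{k-1}\vec p_{k-1},$$ and $$d_k=\|A\vec q_k-\vec x_k\|_2,\qquad \vec p_k=\frac{A\vec q_k-\vec x_k}{d_k}.$$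
   Context: Rational Krylov subspaces: for $M=A^TA$ and real or infinite poles $\xi_1,\xi_2,\dots$ that are not eigenvalues of $M$, let $q_{j-1}(z)=\prod_{i=1}^{j-1}(1-z/\xi_i)$ (with $1/\infty=0$) and $\mathcal{Q}_j(M,\vec b)=q_{j-1}(M)^{-1}\mathrm{span}\{\vec b,M\vec b,\dots,M^{j-1}\vec b\}$. The invariance index is the smallest integer $K$ such that $\mathcal{Q}_K(M,\vec b)=\mathcal{Q}_{K+1}(M,\vec b)$; equivalently, the smallest $K$ with $\mathrm{span}\{\vec b,\dots,M^{K-1}\vec b\}=\mathrm{span}\{\vec b,\dots,M^{K}\vec b\}$. Rational Arnoldi algorithm: $\vec q_1=\vec b/\|\vec b\|_2$, and for $j=1,\dots,k-1$ the vector $\vec q_{j+1}$ is obtained by orthonormalizing $(I-\frac{1}{\xi_j}M)^{-1}M\vec q_j$ against $\vec q_1,\dots,\vec q_j$; it is assumed that the algorithm does not break down, i.e. $(I-\frac{1}{\xi_j}M)^{-1}M\vec q_j\in\mathcal{Q}_{j+1}(M,\vec b)\setminus\mathcal{Q}_j(M,\vec b)$ for each $j$. Thus $\vec q_1,\dots,\vec q_j$ is an orthonormal basis of $\mathcal{Q}_j(M,\vec b)$ for each $j\le k$. *)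

theory Defs
  imports
    "HOL-Analysis.Analysis"
    "HOL-Computational_Algebra.Polynomial"
begin

definition is_eigenvalue :: "real^'n^'n \<Rightarrow> real \<Rightarrow> bool" where
  "is_eigenvalue M r \<longleftrightarrow> (\<exists>v. v \<noteq> 0 \<and> M *v v = r *\<^sub>R v)"

(* The power operation ^ on the type real^'n^'n is not the matrix power
   (its multiplication is componentwise). *)
definition mat_power :: "real^'n^'n \<Rightarrow> nat \<Rightarrow> real^'n^'n" where
  "mat_power M i = (((**) M) ^^ i) (mat 1)"

definition mat_poly :: "real poly \<Rightarrow> real^'n^'n \<Rightarrow> real^'n^'n" where
  "mat_poly p M = (\<Sum>i\<le>degree p. coeff p i *\<^sub>R mat_power M i)"

definition krylov :: "real^'n^'n \<Rightarrow> real^'n \<Rightarrow> nat \<Rightarrow> (real^'n) set" where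
  "krylov M b j = span ((\<lambda>i. mat_power M i *v b) ` {..<j})"

definition invariance_index :: "real^'n^'n \<Rightarrow> real^'n \<Rightarrow> nat" where
  "invariance_index M b = (LEAST K. krylov M b K = krylov M b (K + 1))"

(* Extended reals are used for poles because their arithmetic has 1/\<infinity> = 0. *)
definition recip_pole :: "ereal \<Rightarrow> real" where
  "recip_pole \<xi> = real_of_ereal (1 / \<xi>)"

(* Poles are numbered from 1; pole_poly \<xi> l has the l factors 1 - z/\<xi> 1, ..., 1 - z/\<xi> l. *)
definition pole_poly :: "(nat \<Rightarrow> ereal) \<Rightarrow> nat \<Rightarrow> real poly" where
  "pole_poly \<xi> l = (\<Prod>i=1..l. [:1, - recip_pole (\<xi> i):])"

definition rational_krylov :: "real^'n^'n \<Rightarrow> real^'n \<Rightarrow> (nat \<Rightarrow> ereal) \<Rightarrow> nat \<Rightarrow> (real^'n) set" where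
  "rational_krylov M b \<xi> j =
     (\<lambda>v. matrix_inv (mat_poly (pole_poly \<xi> (j - 1)) M) *v v) ` krylov M b j"

definition arnoldi_direction :: "real^'n^'n \<Rightarrow> ereal \<Rightarrow> real^'n \<Rightarrow> real^'n" where
  "arnoldi_direction M \<xi> v = matrix_inv (mat 1 - recip_pole \<xi> *\<^sub>R M) *v (M *v v)"

definition orthonormalize_against :: "nat \<Rightarrow> (nat \<Rightarrow> 'a::real_inner) \<Rightarrow> 'a \<Rightarrow> 'a" where
  "orthonormalize_against j q w =
     (let u = w - (\<Sum>i=1..j. (q i \<bullet> w) *\<^sub>R q i) in u /\<^sub>R norm u)"

(* q 1, ..., q k are produced by k - 1 Arnoldi steps, none of which breaks down. *)
definition rational_arnoldi ::
    "real^'n^'n \<Rightarrow> real^'n \<Rightarrow> (nat \<Rightarrow> ereal) \<Rightarrow> nat \<Rightarrow> (nat \<Rightarrow> real^'n) \<Rightarrow> bool" where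
  "rational_arnoldi M b \<xi> k q \<longleftrightarrow>
     q 1 = b /\<^sub>R norm b \<and>
     (\<forall>j\<in>{1..<k}.
        arnoldi_direction M (\<xi> j) (q j)
          \<in> rational_krylov M b \<xi> (j + 1) - rational_krylov M b \<xi> j \<and>
        q (j + 1) = orthonormalize_against j q (arnoldi_direction M (\<xi> j) (q j)))"

(* A matrix with k columns, k a natural number, is given by its columns 1, ..., k, and a
   k x k matrix by its entries with indices in {1..k}: columns a = p * B. *)
definition is_qr_decomposition ::
    "nat \<Rightarrow> (nat \<Rightarrow> 'a::real_inner) \<Rightarrow> (nat \<Rightarrow> 'a) \<Rightarrow> (nat \<Rightarrow> nat \<Rightarrow> real) \<Rightarrow> bool" where
  "is_qr_decomposition k a p B \<longleftrightarrow>
     (\<forall>j\<in>{1..k}. a j = (\<Sum>i=1..k. B i j *\<^sub>R p i)) \<and>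
     (\<forall>i\<in>{1..k}. \<forall>j\<in>{1..k}. p i \<bullet> p j = (if i = j then 1 else 0)) \<and>
     (\<forall>i\<in>{1..k}. \<forall>j\<in>{1..k}. j < i \<longrightarrow> B i j = 0) \<and>
     (\<forall>i\<in>{1..k}. B i i > 0)"

end

theory Submission
  imports Defs
begin

text \<open>Write \<open>M\<close> for the matrix \<open>A\<^sup>T A\<close>. For \<open>i \<le> k - 2\<close> the vector \<open>p\<^sub>i\<close> is \<open>A w\<close> with \<open>w\<close> in the
  rational Krylov space \<open>Q\<close> of index \<open>k - 2\<close>, so \<open>B\<^sub>i\<^sub>j = q\<^sub>j \<bullet> M w\<close>. The space \<open>M Q\<close> lies in
  \<open>Q\<close> plus a single line, and both \<open>q\<^bsub>k-1\<^esub>\<close> and \<open>q\<^sub>k\<close> are orthogonal to \<open>Q\<close>. Hence the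
  functionals \<open>w \<mapsto> q\<^bsub>k-1\<^esub> \<bullet> M w\<close> and \<open>w \<mapsto> q\<^sub>k \<bullet> M w\<close> on \<open>Q\<close> are proportional,
  which makes the first \<open>k - 2\<close> entries of the last two columns of \<open>B\<close> proportional.\<close>

section \<open>Polynomials in a matrix, acting on vectors\<close>

lemma mat_poly_mult_vec:
  fixes M :: "real^'n^'n"
  assumes "degree p \<le> n"
  shows "mat_poly p M *v v = (\<Sum>i\<le>n. coeff p i *\<^sub>R (mat_power M i *v v))"
proof -
  have lin: "linear (\<lambda>A::real^'n^'n. A *v v)"
    by (intro linearI) (simp_all add: matrix_vector_mult_add_rdistrib scaleR_matrix_vector_assoc)
  have "mat_poly p M *v v = (\<Sum>i\<le>degree p. coeff p i *\<^sub>R (mat_power M i *v v))"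
    unfolding mat_poly_def
    by (simp add: linear_sum[OF lin] scaleR_matrix_vector_assoc)
  also have "\<dots> = (\<Sum>i\<le>n. coeff p i *\<^sub>R (mat_power M i *v v))"
    using assms by (intro sum.mono_neutral_left) (auto simp: coeff_eq_0)
  finally show ?thesis .
qed

lemma mat_power_Suc_mult_vec: "mat_power M (Suc i) *v v = M *v (mat_power M i *v v)"
  by (simp add: mat_power_def matrix_vector_mul_assoc)

lemma mat_power_mult_vec_commute: "mat_power M i *v (M *v v) = M *v (mat_power M i *v v)"
  by (induction i) (simp_all add: mat_power_Suc_mult_vec, simp add: mat_power_def)

lemma mat_poly_mult_vec_commute:
  "mat_poly p M *v (M *v v) = M *v (mat_poly p M *v v)"
  by (simp add: mat_poly_mult_vec[OF order_refl] mat_power_mult_vec_commute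
      matrix_vector_mult_scaleR linear_sum[OF matrix_vector_mul_linear])

text \<open>The coefficient of index i + 1 in the product is that of \<open>p\<close> minus r times
  the preceding one, so the sum splits into \<open>p\<close> applied to v and a shifted copy
  carrying one more \<open>M\<close>. It lets \<open>pole_poly\<close> be handled factor by
  factor.\<close>

lemma mat_poly_linear_factor_mult_vec:
  "mat_poly ([:1, - r:] * p) M *v v
    = (mat 1 - r *\<^sub>R M) *v (mat_poly p M *v v)"
proof -
  let ?n = "degree p"
  let ?f = "\<lambda>i. coeff p i *\<^sub>R (mat_power M i *v v)"
  have coeff: "coeff ([:1, - r:] * p) (Suc i) = coeff p (Suc i) - r * coeff p i" for i
    by simp
  have "mat_poly ([:1, - r:] * p) M *v v
      = (\<Sum>i\<le>Suc ?n. coeff ([:1, - r:] * p) i *\<^sub>R (mat_power M i *v v))"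
    by (rule mat_poly_mult_vec) (rule order_trans[OF degree_mult_le], simp)
  also have "\<dots> = ?f 0 + (\<Sum>i\<le>?n. ?f (Suc i)) - r *\<^sub>R (M *v (\<Sum>i\<le>?n. ?f i))"
    unfolding sum.atMost_Suc_shift coeff
    by (simp add: mat_power_Suc_mult_vec linear_sum[OF matrix_vector_mul_linear]
        matrix_vector_mult_scaleR scaleR_diff_left sum_subtractf scaleR_sum_right)
  \<comment> \<open>The shifted sum runs up to index \<open>Suc ?n\<close>, whose term vanishes
    because it exceeds the degree of \<open>p\<close>.\<close>
  also have "?f 0 + (\<Sum>i\<le>?n. ?f (Suc i)) = (\<Sum>i\<le>?n. ?f i)"
    using sum.atMost_Suc_shift[of ?f ?n] by (simp add: coeff_eq_0)
  finally show ?thesis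
    by (simp add: mat_poly_mult_vec[OF order_refl] matrix_vector_mult_diff_rdistrib
        scaleR_matrix_vector_assoc)
qed

section \<open>Invertibility of the denominator polynomials\<close>

lemma pole_poly_Suc: "pole_poly \<xi> (Suc l) = [:1, - recip_pole (\<xi> (Suc l)):] * pole_poly \<xi> l"
  by (simp add: pole_poly_def mult.commute)

text \<open>At an infinite pole the reciprocal is 0 and the factor is the identity. At a finite pole
  r, a kernel vector satisfies M v = r v, so a nonzero one would be an eigenvector.\<close>

lemma pole_factor_mult_vec_eq_0:
  fixes M :: "real^'n^'n"
  assumes pole: "\<xi> \<in> (range ereal \<union> {\<infinity>}) - {0}"
    and no_eig: "\<And>r. \<xi> = ereal r \<Longrightarrow> \<not> is_eigenvalue M r"
    and ker: "(mat 1 - recip_pole \<xi> *\<^sub>R M) *v v = 0"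
  shows "v = 0"
proof -
  have v: "v = recip_pole \<xi> *\<^sub>R (M *v v)"
    using ker by (simp add: matrix_vector_mult_diff_rdistrib scaleR_matrix_vector_assoc)
  consider "\<xi> = \<infinity>" | r where "\<xi> = ereal r" "r \<noteq> 0"
    using pole by (cases \<xi>) auto
  then show ?thesis
  proof cases
    case 1
    then show ?thesis using v by (simp add: recip_pole_def)
  next
    case 2
    then have "recip_pole \<xi> = 1 / r"
      by (simp add: recip_pole_def one_ereal_def)
    then have "r *\<^sub>R v = M *v v"
      using v 2 by (metis divide_self_if mult.commute scaleR_one scaleR_scaleR
          times_divide_eq_right mult.right_neutral)
    then show ?thesis
      using no_eig[OF 2(1)] unfolding is_eigenvalue_def by metis
  qed
qed

lemma invertible_pole_poly:
  fixes M :: "real^'n^'n"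
  assumes "\<And>i. i \<in> {1..l} \<Longrightarrow> \<xi> i \<in> (range ereal \<union> {\<infinity>}) - {0}"
    and "\<And>i r. i \<in> {1..l} \<Longrightarrow> \<xi> i = ereal r \<Longrightarrow> \<not> is_eigenvalue M r"
  shows "invertible (mat_poly (pole_poly \<xi> l) M)"
proof -
  have "v = 0" if "mat_poly (pole_poly \<xi> l) M *v v = 0" for v
    using assms that
  proof (induction l)
    case 0
    then show ?case
      by (simp add: pole_poly_def mat_poly_mult_vec[OF order_refl] mat_power_def)
  next
    case (Suc l)
    have "(mat 1 - recip_pole (\<xi> (Suc l)) *\<^sub>R M) *v (mat_poly (pole_poly \<xi> l) M *v v) = 0"
      using Suc.prems(3) unfolding pole_poly_Suc mat_poly_linear_factor_mult_vec .
    then have "mat_poly (pole_poly \<xi> l) M *v v = 0"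
      by (rule pole_factor_mult_vec_eq_0[rotated -1])
        (use Suc.prems(1,2)[of "Suc l"] in simp_all)
    then show ?case
      by (intro Suc.IH Suc.prems(1,2)) auto
  qed
  then show ?thesis
    unfolding invertible_left_inverse matrix_left_invertible_ker by blast
qed

lemma matrix_inv_mult_vec:
  fixes P :: "real^'n^'n"
  assumes "invertible P"
  shows "P *v (matrix_inv P *v v) = v" "matrix_inv P *v (P *v v) = v"
proof -
  have "P ** matrix_inv P = mat 1 \<and> matrix_inv P ** P = mat 1"
    using assms unfolding invertible_def matrix_inv_def by (rule someI_ex)
  then show "P *v (matrix_inv P *v v) = v" "matrix_inv P *v (P *v v) = v"
    by (simp_all add: matrix_vector_mul_assoc)
qed

section \<open>Rational Krylov spaces, seen as preimages of polynomial Krylov spaces\<close>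

lemma mem_rational_krylov_iff:
  assumes "invertible (mat_poly (pole_poly \<xi> (j - 1)) M)"
  shows "v \<in> rational_krylov M b \<xi> j
    \<longleftrightarrow> mat_poly (pole_poly \<xi> (j - 1)) M *v v \<in> krylov M b j"
  unfolding rational_krylov_def image_iff
  by (metis matrix_inv_mult_vec[OF assms])

lemma krylov_mono: "i \<le> j \<Longrightarrow> krylov M b i \<subseteq> krylov M b j"
  unfolding krylov_def by (intro span_mono image_mono) auto

lemma mult_vec_mem_krylov_Suc:
  assumes "v \<in> krylov M b j"
  shows "M *v v \<in> krylov M b (Suc j)"
proof -
  have "M *v v \<in> (*v) M ` krylov M b j"
    using assms by blast
  also have "\<dots> = span ((\<lambda>i. mat_power M (Suc i) *v b) ` {..<j})"
    unfolding krylov_def linear_span_image[OF matrix_vector_mul_linear, symmetric] image_image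
    by (simp add: mat_power_Suc_mult_vec)
  also have "\<dots> \<subseteq> krylov M b (Suc j)"
    unfolding krylov_def by (intro span_mono) auto
  finally show ?thesis .
qed

lemma subspace_rational_krylov: "subspace (rational_krylov M b \<xi> j)"
  unfolding rational_krylov_def krylov_def
  by (intro linear_subspace_image matrix_vector_mul_linear subspace_span)

lemma dim_rational_krylov_le: "dim (rational_krylov M b \<xi> j) \<le> j"
proof -
  have "dim (rational_krylov M b \<xi> j) \<le> dim (krylov M b j)"
    unfolding rational_krylov_def by (intro dim_image_le matrix_vector_mul_linear)
  also have "\<dots> \<le> card ((\<lambda>i. mat_power M i *v b) ` {..<j})"
    unfolding krylov_def dim_span by (intro dim_le_card') simp
  also have "\<dots> \<le> j"
    using card_image_le[of "{..<j}"] by simp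
  finally show ?thesis .
qed

text \<open>Enlarging the denominator by the factor of pole j multiplies the numerator by the same
  factor, which raises its degree by at most one. For j = 0 the truncated index j - 1 would add no
  factor.\<close>

lemma rational_krylov_Suc_mono:
  assumes inv: "invertible (mat_poly (pole_poly \<xi> (j - 1)) M)"
    "invertible (mat_poly (pole_poly \<xi> j) M)"
    and "j \<ge> 1"
  shows "rational_krylov M b \<xi> j \<subseteq> rational_krylov M b \<xi> (Suc j)"
proof
  fix v
  assume "v \<in> rational_krylov M b \<xi> j"
  then have y: "mat_poly (pole_poly \<xi> (j - 1)) M *v v \<in> krylov M b j" (is "?y \<in> _")
    by (simp add: mem_rational_krylov_iff[OF inv(1)])
  have "mat_poly (pole_poly \<xi> j) M *v v = ?y - recip_pole (\<xi> j) *\<^sub>R (M *v ?y)"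
    using pole_poly_Suc[of \<xi> "j - 1"] \<open>j \<ge> 1\<close>
    by (simp add: mat_poly_linear_factor_mult_vec matrix_vector_mult_diff_rdistrib
        scaleR_matrix_vector_assoc del: mult_pCons_left)
  also have "\<dots> \<in> krylov M b (Suc j)"
    using y mult_vec_mem_krylov_Suc[OF y] krylov_mono[of j "Suc j" M b]
    unfolding krylov_def by (intro span_diff span_mul) auto
  finally show "v \<in> rational_krylov M b \<xi> (Suc j)"
    using inv(2) by (simp add: mem_rational_krylov_iff)
qed

text \<open>Since \<open>M\<close> commutes with the denominator, it raises the numerator degree by
  at most one, so \<open>M\<close> maps the space into itself plus one line. The point is that u is
  chosen before w.\<close>

lemma rational_krylov_mult_vec:
  assumes inv: "invertible (mat_poly (pole_poly \<xi> (j - 1)) M)"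
  obtains u where "\<And>w. w \<in> rational_krylov M b \<xi> j \<Longrightarrow>
    \<exists>t. M *v w - t *\<^sub>R u \<in> rational_krylov M b \<xi> j"
proof
  let ?P = "mat_poly (pole_poly \<xi> (j - 1)) M"
  \<comment> \<open>The only new generator of \<open>krylov M b (Suc j)\<close>, divided by the
    denominator.\<close>
  let ?u = "matrix_inv ?P *v (mat_power M j *v b)"
  fix w
  assume "w \<in> rational_krylov M b \<xi> j"
  then have "M *v (?P *v w) \<in> krylov M b (Suc j)"
    by (intro mult_vec_mem_krylov_Suc) (simp add: mem_rational_krylov_iff[OF inv])
  then obtain t where "M *v (?P *v w) - t *\<^sub>R (mat_power M j *v b) \<in> krylov M b j"
    unfolding krylov_def lessThan_Suc image_insert span_breakdown_eq by blast
  then have "?P *v (M *v w - t *\<^sub>R ?u) \<in> krylov M b j"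
    by (simp add: mat_poly_mult_vec_commute matrix_vector_mult_diff_distrib
        matrix_vector_mult_scaleR matrix_inv_mult_vec(1)[OF inv] del: One_nat_def)
  then show "\<exists>t. M *v w - t *\<^sub>R ?u \<in> rational_krylov M b \<xi> j"
    by (auto simp: mem_rational_krylov_iff[OF inv])
qed

text \<open>Modulo the space, M w and M w' are multiples of one vector u, and a and a' annihilate
  the space. The 2 x 2 matrix of pairings thus has rank at most one; the determinant form avoids
  division.\<close>

lemma rational_krylov_inner_proportional:
  assumes inv: "invertible (mat_poly (pole_poly \<xi> (j - 1)) M)"
    and a: "\<And>w. w \<in> rational_krylov M b \<xi> j \<Longrightarrow> a \<bullet> w = 0"
    and a': "\<And>w. w \<in> rational_krylov M b \<xi> j \<Longrightarrow> a' \<bullet> w = 0"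
    and w: "w \<in> rational_krylov M b \<xi> j" and w': "w' \<in> rational_krylov M b \<xi> j"
  shows "(a \<bullet> (M *v w)) * (a' \<bullet> (M *v w')) = (a' \<bullet> (M *v w)) * (a \<bullet> (M *v w'))"
proof -
  obtain u where "\<And>w. w \<in> rational_krylov M b \<xi> j \<Longrightarrow>
      \<exists>t. M *v w - t *\<^sub>R u \<in> rational_krylov M b \<xi> j"
    using rational_krylov_mult_vec[OF inv] by blast
  then obtain t t' where "M *v w - t *\<^sub>R u \<in> rational_krylov M b \<xi> j"
      "M *v w' - t' *\<^sub>R u \<in> rational_krylov M b \<xi> j"
    using w w' by blast
  then have "a \<bullet> (M *v w) = t * (a \<bullet> u)" "a' \<bullet> (M *v w) = t * (a' \<bullet> u)"
      "a \<bullet> (M *v w') = t' * (a \<bullet> u)" "a' \<bullet> (M *v w') = t' * (a' \<bullet> u)"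
    using a a' by (fastforce simp: inner_diff_right)+
  then show ?thesis by simp
qed

section \<open>Orthonormality and span of the Arnoldi vectors\<close>

lemma inner_orthonormal_sum:
  fixes q :: "nat \<Rightarrow> 'a::real_inner"
  assumes "finite I" "j \<in> I" "\<And>i. i \<in> I \<Longrightarrow> q j \<bullet> q i = (if j = i then 1 else 0)"
  shows "q j \<bullet> (\<Sum>i\<in>I. c i *\<^sub>R q i) = c j"
proof -
  have "q j \<bullet> (\<Sum>i\<in>I. c i *\<^sub>R q i) = (\<Sum>i\<in>I. if j = i then c i else 0)"
    unfolding inner_sum_right using assms by (intro sum.cong) auto
  then show ?thesis using assms by simp
qed

text \<open>The projection of w lies in S while w does not, so the residual is nonzero and can be
  normalized. In the Arnoldi process S is the current rational Krylov space.\<close>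

lemma orthonormalize_against:
  fixes q :: "nat \<Rightarrow> 'a::real_inner"
  assumes orth: "\<And>i i'. i \<in> {1..j} \<Longrightarrow> i' \<in> {1..j} \<Longrightarrow> q i \<bullet> q i' = (if i = i' then 1 else 0)"
    and S: "subspace S" "q ` {1..j} \<subseteq> S" and w: "w \<notin> S"
  shows "norm (orthonormalize_against j q w) = 1"
    and "i \<in> {1..j} \<Longrightarrow> q i \<bullet> orthonormalize_against j q w = 0"
proof -
  define s where "s = (\<Sum>i=1..j. (q i \<bullet> w) *\<^sub>R q i)"
  have "s \<in> S"
    unfolding s_def using S by (intro subspace_sum subspace_scale) auto
  then have "w - s \<noteq> 0" using w by auto
  then show "norm (orthonormalize_against j q w) = 1"
    by (simp add: orthonormalize_against_def s_def[symmetric] Let_def del: One_nat_def)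
  assume i: "i \<in> {1..j}"
  then have "q i \<bullet> s = q i \<bullet> w"
    unfolding s_def using orth by (intro inner_orthonormal_sum) auto
  then show "q i \<bullet> orthonormalize_against j q w = 0"
    by (simp add: orthonormalize_against_def s_def[symmetric] inner_diff_right Let_def
        del: One_nat_def)
qed

lemma rational_arnoldi_orthonormal:
  fixes M :: "real^'n^'n"
  assumes inv: "\<And>l. l < k \<Longrightarrow> invertible (mat_poly (pole_poly \<xi> l) M)"
    and "k \<ge> 2" and arnoldi: "rational_arnoldi M b \<xi> k q"
    and j: "1 \<le> j" "j \<le> k"
  shows "q ` {1..j} \<subseteq> rational_krylov M b \<xi> j"
    and "\<lbrakk>i \<in> {1..j}; i' \<in> {1..j}\<rbrakk> \<Longrightarrow> q i \<bullet> q i' = (if i = i' then 1 else 0)"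
proof -
  let ?Q = "rational_krylov M b \<xi>"
  have "q ` {1..j} \<subseteq> ?Q j \<and>
      (\<forall>i\<in>{1..j}. \<forall>i'\<in>{1..j}. q i \<bullet> q i' = (if i = i' then 1 else 0))"
    using j
  proof (induction j rule: dec_induct)
    case base
    \<comment> \<open>This follows from the absence of breakdown in step 1: with b = 0 the second
      space is trivial, so nothing lies in it and outside the first.\<close>
    have "b \<noteq> 0"
    proof
      assume "b = 0"
      then have "krylov M b 2 \<subseteq> span {0}"
        unfolding krylov_def by (intro span_mono) auto
      then have "?Q 2 \<subseteq> {0}"
        unfolding rational_krylov_def by auto
      moreover have "\<exists>v. v \<in> ?Q 2 - ?Q 1"
        using arnoldi \<open>k \<ge> 2\<close> unfolding rational_arnoldi_def
        by (metis Suc_1 Suc_eq_plus1 Suc_le_lessD atLeastLessThan_iff order_refl)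
      ultimately show False
        using subspace_0[OF subspace_rational_krylov[of M b \<xi> 1]] by auto
    qed
    moreover have "b \<in> ?Q 1"
      using inv[of 0] \<open>k \<ge> 2\<close>
      by (simp add: mem_rational_krylov_iff krylov_def pole_poly_def
          mat_poly_mult_vec[OF order_refl] mat_power_def span_base)
    then have "q 1 \<in> ?Q 1"
      using arnoldi subspace_scale[OF subspace_rational_krylov]
      unfolding rational_arnoldi_def by metis
    moreover have "norm (q 1) = 1"
      using arnoldi \<open>b \<noteq> 0\<close> unfolding rational_arnoldi_def by simp
    ultimately show ?case by (simp add: norm_eq_1)
  next
    case (step j)
    let ?w = "arnoldi_direction M (\<xi> j) (q j)"
    have IH: "q ` {1..j} \<subseteq> ?Q j"
        "\<And>i i'. \<lbrakk>i \<in> {1..j}; i' \<in> {1..j}\<rbrakk> \<Longrightarrow> q i \<bullet> q i' = (if i = i' then 1 else 0)"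
      using step by auto
    have w: "?w \<in> ?Q (Suc j)" "?w \<notin> ?Q j" and q: "q (Suc j) = orthonormalize_against j q ?w"
      using arnoldi step unfolding rational_arnoldi_def by auto
    have "?Q j \<subseteq> ?Q (Suc j)"
      using step by (intro rational_krylov_Suc_mono inv) auto
    with IH(1) have sub: "q ` {1..j} \<subseteq> ?Q (Suc j)" by blast
    then have "q (Suc j) \<in> ?Q (Suc j)"
      unfolding q orthonormalize_against_def Let_def using w(1)
      by (intro subspace_scale subspace_diff subspace_sum subspace_rational_krylov) auto
    with sub have "q ` {1..Suc j} \<subseteq> ?Q (Suc j)"
      by (auto simp: atLeastAtMostSuc_conv)
    moreover note orthonormalize_against[OF IH(2) subspace_rational_krylov IH(1) w(2), folded q]
    ultimately show ?case
      using IH(2) by (auto simp: atLeastAtMostSuc_conv norm_eq_1 inner_commute)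
  qed
  then show "q ` {1..j} \<subseteq> ?Q j"
    "\<lbrakk>i \<in> {1..j}; i' \<in> {1..j}\<rbrakk> \<Longrightarrow> q i \<bullet> q i' = (if i = i' then 1 else 0)"
    by blast+
qed

text \<open>The j orthonormal vectors are independent in a space of dimension at most j, hence they
  span it.\<close>

lemma rational_arnoldi_span:
  fixes M :: "real^'n^'n"
  assumes "\<And>l. l < k \<Longrightarrow> invertible (mat_poly (pole_poly \<xi> l) M)"
    and "k \<ge> 2" "rational_arnoldi M b \<xi> k q" "1 \<le> j" "j \<le> k"
  shows "span (q ` {1..j}) = rational_krylov M b \<xi> j"
proof -
  note orth = rational_arnoldi_orthonormal[OF assms]
  have inj: "inj_on q {1..j}"
    by (rule inj_onI) (metis orth(2) zero_neq_one)
  have "0 \<notin> q ` {1..j}"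
    using orth(2) by (metis imageE inner_zero_left zero_neq_one)
  moreover have "pairwise orthogonal (q ` {1..j})"
    unfolding pairwise_def orthogonal_def using orth(2) by auto
  ultimately have "independent (q ` {1..j})"
    by (rule pairwise_orthogonal_independent[rotated])
  moreover have "dim (rational_krylov M b \<xi> j) \<le> card (q ` {1..j})"
    using dim_rational_krylov_le[of M b \<xi> j] by (simp add: card_image[OF inj] del: One_nat_def)
  ultimately have "rational_krylov M b \<xi> j \<subseteq> span (q ` {1..j})"
    using orth(1) by (intro card_ge_dim_independent)
  then show ?thesis
    using span_minimal[OF orth(1) subspace_rational_krylov] by blast
qed

section \<open>Entries and columns of a QR decomposition\<close>

lemma qr_coeff_eq_inner:
  assumes "is_qr_decomposition k a p B" "i \<in> {1..k}" "j \<in> {1..k}"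
  shows "B i j = p i \<bullet> a j"
proof -
  have "p i \<bullet> a j = p i \<bullet> (\<Sum>l=1..k. B l j *\<^sub>R p l)"
    using assms unfolding is_qr_decomposition_def by auto
  also have "\<dots> = B i j"
    using assms unfolding is_qr_decomposition_def by (intro inner_orthonormal_sum) auto
  finally show ?thesis by simp
qed

lemma qr_column:
  assumes "is_qr_decomposition k a p B" "j \<in> {1..k}"
  shows "a j = (\<Sum>i=1..j-1. B i j *\<^sub>R p i) + B j j *\<^sub>R p j"
proof -
  have "a j = (\<Sum>i=1..k. B i j *\<^sub>R p i)"
    using assms unfolding is_qr_decomposition_def by auto
  also have "\<dots> = (\<Sum>i=1..j. B i j *\<^sub>R p i)"
    using assms unfolding is_qr_decomposition_def by (intro sum.mono_neutral_right) auto
  also have "\<dots> = (\<Sum>i=1..j-1. B i j *\<^sub>R p i) + B j j *\<^sub>R p j"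
    using assms by (cases j) simp_all
  finally show ?thesis .
qed

text \<open>Column j can be solved for \<open>p j\<close> because the diagonal entry is positive;
  the earlier \<open>p i\<close> are covered by induction.\<close>

lemma qr_orthonormal_mem_span:
  assumes qr: "is_qr_decomposition k a p B" and "j \<in> {1..k}"
  shows "p j \<in> span (a ` {1..j})"
  using \<open>j \<in> {1..k}\<close>
proof (induction j rule: less_induct)
  case (less j)
  have "p i \<in> span (a ` {1..j})" if "i \<in> {1..j-1}" for i
  proof -
    have "p i \<in> span (a ` {1..i})"
      using less that by auto
    moreover have "span (a ` {1..i}) \<subseteq> span (a ` {1..j})"
      using that by (intro span_mono image_mono) auto
    ultimately show ?thesis by blast
  qed
  then have "a j - (\<Sum>i=1..j-1. B i j *\<^sub>R p i) \<in> span (a ` {1..j})"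
    using less.prems by (intro span_diff span_sum span_mul span_base[of "a j"]) auto
  then have "B j j *\<^sub>R p j \<in> span (a ` {1..j})"
    unfolding qr_column[OF qr less.prems] by simp
  moreover have "B j j > 0"
    using qr less.prems unfolding is_qr_decomposition_def by blast
  ultimately show ?case
    using span_mul[of "B j j *\<^sub>R p j" "a ` {1..j}" "1 / B j j"] by simp
qed

text \<open>Turns an entry of \<open>B\<close> in row i, once \<open>p i\<close> is written as
  \<open>A *v w\<close>, into a pairing of some \<open>q j\<close> with \<open>M\<close> applied to
  w.\<close>

lemma inner_mult_vec_eq_inner_gram:
  fixes A :: "real^'n^'m"
  shows "(A *v u) \<bullet> (A *v v) = v \<bullet> ((transpose A ** A) *v u)"
proof -
  have "v \<bullet> ((transpose A ** A) *v u) = (v v* transpose A) \<bullet> (A *v u)"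
    unfolding dot_lmul_matrix matrix_vector_mul_assoc ..
  then show ?thesis by (simp add: inner_commute)
qed

theorem mainTheorem4:
  fixes A :: "real^'n^'m" and b :: "real^'n" and k :: nat
    and \<xi> :: "nat \<Rightarrow> ereal"
    and q :: "nat \<Rightarrow> real^'n" and p x :: "nat \<Rightarrow> real^'m"
    and B :: "nat \<Rightarrow> nat \<Rightarrow> real" and d \<beta> \<gamma> :: "nat \<Rightarrow> real"
  assumes "k \<ge> 3"
    and "k + 1 < invariance_index (transpose A ** A) b"
    and "\<And>i. i \<in> {1..k-1} \<Longrightarrow> \<xi> i \<in> (range ereal \<union> {\<infinity>}) - {0}"
    and "\<And>i r. i \<in> {1..k-1} \<Longrightarrow> \<xi> i = ereal r \<Longrightarrow> \<not> is_eigenvalue (transpose A ** A) r"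
    and "rational_arnoldi (transpose A ** A) b \<xi> k q"
    and "is_qr_decomposition k (\<lambda>j. A *v q j) p B"
    and "d = (\<lambda>i. B i i)"
    and "\<beta> = (\<lambda>i. B i (i + 1))"
    and "\<gamma> = (\<lambda>i. B i (i + 2))"
    and "x = (\<lambda>j. \<Sum>i=1..j-1. B i j *\<^sub>R p i)"
    and "\<beta> (k - 2) \<noteq> 0"
  shows "\<beta> (k - 1) = p (k - 1) \<bullet> (A *v q k)
    \<and> \<gamma> (k - 2) = p (k - 2) \<bullet> (A *v q k)
    \<and> x k = (\<gamma> (k - 2) / \<beta> (k - 2)) *\<^sub>R x (k - 1) + \<beta> (k - 1) *\<^sub>R p (k - 1)
    \<and> d k = norm (A *v q k - x k)
    \<and> p k = (A *v q k - x k) /\<^sub>R d k"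
proof -
  let ?M = "transpose A ** A"
  let ?Q = "rational_krylov ?M b \<xi>"
  define l where "l = k - 2"
  have k: "k = Suc (Suc l)" and l: "l \<ge> 1"
    using \<open>k \<ge> 3\<close> by (auto simp: l_def)
  have "k \<ge> 2" using k by simp
  note qr = \<open>is_qr_decomposition k (\<lambda>j. A *v q j) p B\<close>
  note arnoldi = \<open>rational_arnoldi ?M b \<xi> k q\<close>
  have inv: "invertible (mat_poly (pole_poly \<xi> i) ?M)" if "i < k" for i
    using that by (intro invertible_pole_poly assms(3,4)) auto
  have span_Q: "span (q ` {1..l}) = ?Q l"
    using l k by (intro rational_arnoldi_span[OF inv \<open>k \<ge> 2\<close> arnoldi]) auto
  \<comment> \<open>With \<open>k = Suc (Suc l)\<close> this concerns exactly the last two Arnoldi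
    vectors.\<close>
  have perp: "q j \<bullet> w = 0" if "w \<in> ?Q l" "j \<in> {Suc l..k}" for j w
  proof -
    have "orthogonal (q j) v" if "v \<in> q ` {1..l}" for v
      using that \<open>j \<in> {Suc l..k}\<close>
        rational_arnoldi_orthonormal(2)[OF inv \<open>k \<ge> 2\<close> arnoldi _ order_refl, of j]
      by (auto simp: orthogonal_def)
    then show ?thesis
      using that(1) orthogonal_to_span[of w "q ` {1..l}" "q j"]
      unfolding span_Q orthogonal_def by blast
  qed
  have p_image: "\<exists>w\<in>?Q l. p i = A *v w" if "i \<in> {1..l}" for i
  proof -
    have "p i \<in> span ((\<lambda>j. A *v q j) ` {1..i})"
      using that k by (intro qr_orthonormal_mem_span[OF qr]) auto
    also have "\<dots> \<subseteq> span ((*v) A ` q ` {1..l})"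
      using that unfolding image_image by (intro span_mono image_mono) auto
    also have "\<dots> = (*v) A ` ?Q l"
      unfolding linear_span_image[OF matrix_vector_mul_linear] span_Q ..
    finally show ?thesis by blast
  qed
  have B: "B i j = p i \<bullet> (A *v q j)" if "i \<in> {1..k}" "j \<in> {1..k}" for i j
    using qr_coeff_eq_inner[OF qr that] .
  \<comment> \<open>The minor of \<open>B\<close> in rows i, l and columns k - 1, k vanishes: the
    proportionality lemma is applied to \<open>q k\<close> and \<open>q (Suc l)\<close>.\<close>
  have minor: "B i k * B l (Suc l) = B i (Suc l) * B l k" if i: "i \<in> {1..l}" for i
  proof -
    obtain w w' where w: "w \<in> ?Q l" "p i = A *v w" "w' \<in> ?Q l" "p l = A *v w'"
      using p_image[OF i] p_image[of l] l by (meson atLeastAtMost_iff order_refl)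
    have "(q k \<bullet> (?M *v w)) * (q (Suc l) \<bullet> (?M *v w'))
        = (q (Suc l) \<bullet> (?M *v w)) * (q k \<bullet> (?M *v w'))"
      using w k by (intro rational_krylov_inner_proportional[OF inv] perp) auto
    then show ?thesis
      using i l k w by (simp add: B inner_mult_vec_eq_inner_gram)
  qed
  \<comment> \<open>This entry is \<beta> at k - 2. Row l therefore fixes the ratio of the two
    columns, namely \<gamma> over \<beta> at k - 2, for all rows up to l.\<close>
  have "B l (Suc l) \<noteq> 0"
    using assms(8,11) by (simp add: l_def)
  then have row: "B i k *\<^sub>R p i = (B l k / B l (Suc l)) *\<^sub>R B i (Suc l) *\<^sub>R p i"
    if "i \<in> {1..l}" for i
    using minor[OF that] by (simp add: field_simps)
  \<comment> \<open>\<open>x k\<close> has one summand more than \<open>x (Suc l)\<close>; that of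
    index k - 1 lies outside the proportional rows and is split off.\<close>
  have x_k: "x k = (B l k / B l (Suc l)) *\<^sub>R x (Suc l) + B (Suc l) k *\<^sub>R p (Suc l)"
  proof -
    have "x k = (\<Sum>i=1..l. B i k *\<^sub>R p i) + B (Suc l) k *\<^sub>R p (Suc l)"
      by (simp add: assms(10) k)
    also have "(\<Sum>i=1..l. B i k *\<^sub>R p i) = (B l k / B l (Suc l)) *\<^sub>R x (Suc l)"
      unfolding assms(10) scaleR_sum_right diff_Suc_1 by (intro sum.cong refl row)
    finally show ?thesis .
  qed
  \<comment> \<open>Only the diagonal term of column k is left; as \<open>p k\<close> is a unit
    vector and \<open>B k k\<close> is positive, the norm of the residual is
    \<open>d k\<close>.\<close>
  have residual: "A *v q k - x k = B k k *\<^sub>R p k"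
    using qr_column[OF qr, of k] k by (simp add: assms(10))
  have pk: "norm (p k) = 1" "B k k > 0"
    using qr k unfolding is_qr_decomposition_def by (auto simp: norm_eq_1)
  have idx: "k - 1 = Suc l" "k - 2 = l" "Suc l + 1 = k" "l + 2 = k" "l + 1 = Suc l"
    using k by auto
  show ?thesis
    unfolding idx assms(7-9) using x_k residual pk B[of "Suc l" k] B[of l k] k l
    by (simp add: idx)
qed

end
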